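(* Consider the Gaussian 1-factor model $$Z_j=\alpha_jW+\psi_j\epsilon_j,\quad j=1,2,\dots,$$ where $W,\epsilon_1,\epsilon_2,\dots$ are mutually independent $N(0,1)$ random variables, $-1<\alpha_j<1$ and $\psi_j^2=1-\alpha_j^2$. Suppose there is a realized infinite sequence of observed variables $z_1,z_2,\dots$ and a realized infinite sequence of disturbance terms $e_1,e_2,\dots$ with realized latent variable $w^0$ (independent of the dimension $D$) from this model. For the sequences truncated to the first $D$ variables, let $\boldsymbol{z}_D=(z_1,\dots,z_D)^T$, $\boldsymbol{e}_D=(e_1,\dots,e_D)^T$, and let the loading matrix (vector) be $\boldsymbol{A}_D=(\alpha_1,\dots,\alpha_D)^T$. Assume $$-1<\liminf_{j\to\infty}\alpha_j<\limsup_{j\to\infty}\alpha_j<1,\qquad \lim_{D\to\infty}D^{-1}\sum_{j=1}^D|\alpha_j| = \text{const},\quad \text{const}\ne 0.$$ Let $\widetilde w_D$ be the factor score $$\widetilde w_D=\boldsymbol{A}_D^T(\boldsymbol{A}_D\boldsymbol{A}_D^T+\boldsymbol{\Psi}_D^2)^{-1}\boldsymbol{z}_D=(1+\boldsymbol{A}_D^T\boldsymbol{\Psi}_D^{-2}\boldsymbol{A}_D)^{-1}\boldsymbol{A}_D^T\boldsymbol{\Psi}_D^{-2}\boldsymbol{z}_D,\qquad \boldsymbol{\Psi}_D^2=\mathrm{diag}(\psi_1^2,\dots,\psi_D^2).$$ Then $\widetilde w_D-w^0=O_p(D^{-1/2})$ as $D\to\infty$.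
   Context: The realized values satisfy $z_j=\alpha_jw^0+\psi_je_j$. The symbol $O_p$ refers to the randomness of the sequence of disturbances $\epsilon_1,\epsilon_2,\dots$ (i.e. of $Z_1,Z_2,\dots$ given $W=w^0$), of which $e_1,e_2,\dots$ is a realization. The factor score equals the conditional expectation $\mathrm{E}(W\mid \boldsymbol{Z}_D=\boldsymbol{z}_D)$. *)

theory Defs
  imports
    "HOL-Probability.Probability"
    "Jordan_Normal_Form.Gauss_Jordan_Elimination"
begin

text \<open>All sequences (loadings, disturbances, observations) are indexed by \<open>j \<ge> 1\<close>; the values at
  index \<open>0\<close> are irrelevant. Only \<open>psi j ^ 2\<close> is determined by the model, the sign of \<open>psi j\<close> is free.\<close>

locale gaussian_one_factor = prob_space M for M :: "'a measure" +
  fixes W :: "'a \<Rightarrow> real"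
    and eps Z :: "nat \<Rightarrow> 'a \<Rightarrow> real"
    and alpha psi :: "nat \<Rightarrow> real"
  assumes W_normal: "distributed M lborel W std_normal_density"
    and eps_normal: "\<And>j. j \<ge> 1 \<Longrightarrow> distributed M lborel (eps j) std_normal_density"
    and W_eps_indep: "indep_vars (\<lambda>_. borel) (\<lambda>j. if j = 0 then W else eps j) UNIV"
      \<comment> \<open>\<open>W\<close> is placed at the unused index \<open>0\<close>: this is mutual independence of \<open>W, eps 1, eps 2, \<dots>\<close>\<close>
    and alpha_bounds: "\<And>j. j \<ge> 1 \<Longrightarrow> -1 < alpha j \<and> alpha j < 1"
    and psi_sq: "\<And>j. j \<ge> 1 \<Longrightarrow> (psi j)\<^sup>2 = 1 - (alpha j)\<^sup>2"
    and Z_eq: "\<And>j \<omega>. j \<ge> 1 \<Longrightarrow> \<omega> \<in> space M \<Longrightarrow> Z j \<omega> = alpha j * W \<omega> + psi j * eps j \<omega>"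

definition realized_obs :: "(nat \<Rightarrow> real) \<Rightarrow> (nat \<Rightarrow> real) \<Rightarrow> real \<Rightarrow> (nat \<Rightarrow> real) \<Rightarrow> nat \<Rightarrow> real" where
  "realized_obs alpha psi w0 e j = alpha j * w0 + psi j * e j"

text \<open>The law of \<open>realized_obs alpha psi w (\<lambda>j. eps j \<omega>)\<close>, with \<open>w\<close> fixed and \<open>\<omega>\<close> random, is a
  regular conditional distribution of the sequence \<open>Z\<close> given \<open>W = w\<close>.\<close>

lemma (in gaussian_one_factor) conditional_law_given_W:
  assumes A: "A \<in> sets borel" and B: "B \<in> sets (Pi\<^sub>M {1..} (\<lambda>_. borel))"
  shows "emeasure M {\<omega> \<in> space M. W \<omega> \<in> A \<and> (\<lambda>j\<in>{1..}. Z j \<omega>) \<in> B} =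
    (\<integral>\<^sup>+ w. indicator A w *
       emeasure M {\<omega> \<in> space M. (\<lambda>j\<in>{1..}. realized_obs alpha psi w (\<lambda>j. eps j \<omega>) j) \<in> B}
     \<partial>distr M borel W)"
proof -
  define N0 where "N0 = Pi\<^sub>M {0::nat} (\<lambda>_. borel :: real measure)"
  define N where "N = Pi\<^sub>M {1::nat..} (\<lambda>_. borel :: real measure)"
  define X where "X = (\<lambda>j. if j = 0 then W else eps j)"
  define F where "F = (\<lambda>\<omega>. \<lambda>i\<in>{0::nat}. X i \<omega>)"
  define E where "E = (\<lambda>\<omega>. \<lambda>j\<in>{1..}. X j \<omega>)"
  define T where "T = (\<lambda>(w, e). \<lambda>j\<in>{1..}. realized_obs alpha psi w e j)"
  define G where "G w = indicator A w *
       emeasure M {\<omega> \<in> space M. (\<lambda>j\<in>{1..}. realized_obs alpha psi w (\<lambda>j. eps j \<omega>) j) \<in> B}" for w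
  have B': "B \<in> sets N" using B by (simp add: N_def)
  have ind: "indep_var N0 F N E"
    unfolding N0_def N_def F_def E_def
    by (rule indep_var_restrict[where I = UNIV]) (use W_eps_indep in \<open>auto simp: X_def\<close>)
  have F[measurable]: "F \<in> measurable M N0" and E[measurable]: "E \<in> measurable M N"
    using ind by (auto dest: indep_var_rv1 indep_var_rv2)
  have F0: "F \<omega> 0 = W \<omega>" for \<omega> by (simp add: F_def X_def)
  have W[measurable]: "W \<in> measurable M borel"
    using distributed_measurable[OF W_normal] by simp
  have T[measurable]: "T \<in> measurable (borel \<Otimes>\<^sub>M N) N"
    unfolding T_def N_def realized_obs_def case_prod_beta by measurable
  have c0[measurable]: "(\<lambda>f. f 0) \<in> measurable N0 borel"
    unfolding N0_def by measurable
  interpret FF: prob_space "distr M N0 F" by (rule prob_space_distr) (rule F)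
  interpret EE: prob_space "distr M N E" by (rule prob_space_distr) (rule E)
  define R where "R = {p \<in> space (borel \<Otimes>\<^sub>M N). fst p \<in> A \<and> T p \<in> B}"
  have R: "R \<in> sets (borel \<Otimes>\<^sub>M N)"
    unfolding R_def using A B' by measurable
  define Q where "Q = (\<lambda>(f, e). (f 0, e)) -` R \<inter> space (N0 \<Otimes>\<^sub>M N)"
  have Q: "Q \<in> sets (N0 \<Otimes>\<^sub>M N)"
    unfolding Q_def using R by (intro measurable_sets[where A = "borel \<Otimes>\<^sub>M N"]) measurable
  have spE: "E \<omega> \<in> space N" and spF: "F \<omega> \<in> space N0" if "\<omega> \<in> space M" for \<omega>
    using that measurable_space[OF E] measurable_space[OF F] by auto
  have TE: "T (w, E \<omega>) = (\<lambda>j\<in>{1..}. realized_obs alpha psi w (\<lambda>j. eps j \<omega>) j)" for w \<omega>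
    by (auto simp: T_def E_def X_def realized_obs_def fun_eq_iff)
  have TZ: "T (W \<omega>, E \<omega>) = (\<lambda>j\<in>{1..}. Z j \<omega>)" if "\<omega> \<in> space M" for \<omega>
    using that by (auto simp: T_def E_def X_def realized_obs_def Z_eq fun_eq_iff)
  have slice: "emeasure (distr M N E) (Pair w -` R) = G w" for w
  proof -
    have "emeasure (distr M N E) (Pair w -` R) = emeasure M (E -` (Pair w -` R) \<inter> space M)"
      using R by (intro emeasure_distr) (auto intro: sets_Pair1)
    also have "E -` (Pair w -` R) \<inter> space M =
      (if w \<in> A then {\<omega> \<in> space M. (\<lambda>j\<in>{1..}. realized_obs alpha psi w (\<lambda>j. eps j \<omega>) j) \<in> B} else {})"
      by (auto simp: R_def space_pair_measure spE TE simp del: restrict_apply)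
    finally show ?thesis by (auto simp: G_def)
  qed
  have R': "R \<in> sets (borel \<Otimes>\<^sub>M distr M N E)"
    using R by (simp cong: sets_pair_measure_cong)
  have G[measurable]: "G \<in> borel_measurable borel"
    using EE.measurable_emeasure_Pair[OF R'] by (simp add: slice)
  have "{\<omega> \<in> space M. W \<omega> \<in> A \<and> (\<lambda>j\<in>{1..}. Z j \<omega>) \<in> B} = (\<lambda>\<omega>. (F \<omega>, E \<omega>)) -` Q \<inter> space M"
    by (auto simp: Q_def R_def space_pair_measure spE spF F0 TZ simp del: restrict_apply)
  then have "emeasure M {\<omega> \<in> space M. W \<omega> \<in> A \<and> (\<lambda>j\<in>{1..}. Z j \<omega>) \<in> B}
      = emeasure (distr M (N0 \<Otimes>\<^sub>M N) (\<lambda>\<omega>. (F \<omega>, E \<omega>))) Q"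
    using Q by (subst emeasure_distr) auto
  also have "\<dots> = emeasure (distr M N0 F \<Otimes>\<^sub>M distr M N E) Q"
    using ind by (simp add: indep_var_distribution_eq)
  also have "\<dots> = (\<integral>\<^sup>+ f. emeasure (distr M N E) (Pair f -` Q) \<partial>distr M N0 F)"
    using Q by (intro EE.emeasure_pair_measure_alt) (simp cong: sets_pair_measure_cong)
  also have "\<dots> = (\<integral>\<^sup>+ f. G (f 0) \<partial>distr M N0 F)"
  proof (rule nn_integral_cong)
    fix f assume "f \<in> space (distr M N0 F)"
    then have "Pair f -` Q = Pair (f 0) -` R"
      by (auto simp: Q_def R_def space_pair_measure)
    then show "emeasure (distr M N E) (Pair f -` Q) = G (f 0)" by (simp add: slice)
  qed
  also have "\<dots> = (\<integral>\<^sup>+ \<omega>. G (W \<omega>) \<partial>M)"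
    by (subst nn_integral_distr) (auto simp: F0)
  also have "\<dots> = (\<integral>\<^sup>+ w. G w \<partial>distr M borel W)"
    by (subst nn_integral_distr) auto
  finally show ?thesis by (simp add: G_def)
qed

definition mat_inv :: "real Matrix.mat \<Rightarrow> real Matrix.mat" where
  "mat_inv A = the (mat_inverse A)"

definition trunc_vec :: "nat \<Rightarrow> (nat \<Rightarrow> real) \<Rightarrow> real Matrix.vec" where
  "trunc_vec D z = Matrix.vec D (\<lambda>i. z (Suc i))"

definition loading_mat :: "nat \<Rightarrow> (nat \<Rightarrow> real) \<Rightarrow> real Matrix.mat" where
  "loading_mat D alpha = Matrix.mat D 1 (\<lambda>(i, _). alpha (Suc i))"

definition Psi_sq :: "nat \<Rightarrow> (nat \<Rightarrow> real) \<Rightarrow> real Matrix.mat" where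
  "Psi_sq D psi = mat_diag D (\<lambda>i. (psi (Suc i))\<^sup>2)"

text \<open>Both expressions are vectors of dimension 1; the score is their only entry.\<close>

definition factor_score ::
    "(nat \<Rightarrow> real) \<Rightarrow> (nat \<Rightarrow> real) \<Rightarrow> nat \<Rightarrow> (nat \<Rightarrow> real) \<Rightarrow> real" where
  "factor_score alpha psi D z =
     (let A = loading_mat D alpha
      in vec_index (transpose_mat A * mat_inv (A * transpose_mat A + Psi_sq D psi) *\<^sub>v trunc_vec D z) 0)"

definition factor_score_alt ::
    "(nat \<Rightarrow> real) \<Rightarrow> (nat \<Rightarrow> real) \<Rightarrow> nat \<Rightarrow> (nat \<Rightarrow> real) \<Rightarrow> real" where
  "factor_score_alt alpha psi D z =
     (let A = loading_mat D alpha; P = mat_inv (Psi_sq D psi)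
      in vec_index (mat_inv (1\<^sub>m 1 + transpose_mat A * P * A) * transpose_mat A * P *\<^sub>v trunc_vec D z) 0)"

definition bigO_in_prob :: "'a measure \<Rightarrow> (nat \<Rightarrow> 'a \<Rightarrow> real) \<Rightarrow> (nat \<Rightarrow> real) \<Rightarrow> bool" where
  "bigO_in_prob M X r \<longleftrightarrow>
     (\<forall>n. X n \<in> borel_measurable M) \<and>
     (\<forall>\<delta>>0. \<exists>C>0. \<forall>\<^sub>F n in sequentially.
        measure M {\<omega> \<in> space M. \<bar>X n \<omega>\<bar> > C * \<bar>r n\<bar>} < \<delta>)"

end

theory Submission
  imports Defs "Jordan_Normal_Form.Determinant"
begin

text \<open>Put \<open>S\<^sub>D = (\<Sum>j\<le>D. \<alpha>\<^sub>j\<^sup>2 / \<psi>\<^sub>j\<^sup>2)\<close>. By the Sherman--Morrison formula both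
  expressions for the score equal \<open>(1 + S\<^sub>D)\<inverse> (\<Sum>j\<le>D. \<alpha>\<^sub>j z\<^sub>j / \<psi>\<^sub>j\<^sup>2)\<close>, so given \<open>W = w\<^sup>0\<close> the error
  is \<open>(1 + S\<^sub>D)\<inverse> (- w\<^sup>0 + (\<Sum>j\<le>D. (\<alpha>\<^sub>j / \<psi>\<^sub>j) \<epsilon>\<^sub>j))\<close>, whose second moment
  \<open>((w\<^sup>0)\<^sup>2 + S\<^sub>D) / (1 + S\<^sub>D)\<^sup>2\<close> is at most \<open>((w\<^sup>0)\<^sup>2 + 1) / S\<^sub>D\<close>. Since
  \<open>S\<^sub>D \<ge> (\<Sum>j\<le>D. \<alpha>\<^sub>j\<^sup>2) \<ge> (\<Sum>j\<le>D. \<bar>\<alpha>\<^sub>j\<bar>)\<^sup>2 / D\<close> grows at least linearly in \<open>D\<close>, Markov's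
  inequality for the squared error gives the claim.\<close>

section \<open>The factor score in closed form\<close>

text \<open>A right inverse of a square matrix is two-sided, so \<open>A\<close> is a unit of the
  matrix ring. Hence \<open>mat_inverse\<close> does not return \<open>None\<close>,
  \<open>the\<close> yields a genuine inverse, and inverses are unique.\<close>

lemma mat_inv_eqI:
  assumes A: "A \<in> carrier_mat n n" and B: "B \<in> carrier_mat n n" and AB: "A * B = 1\<^sub>m n"
  shows "mat_inv A = B"
proof -
  have BA: "B * A = 1\<^sub>m n" by (rule mat_mult_left_right_inverse[OF A B AB])
  have "A \<in> Units (ring_mat TYPE(real) n ())"
    unfolding Units_def using A B AB BA by (auto simp: ring_mat_def)
  then obtain C where C: "mat_inverse A = Some C"
    using mat_inverse(1)[OF A, of "()"] by (cases "mat_inverse A") auto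
  have AC: "A * C = 1\<^sub>m n" "C * A = 1\<^sub>m n" "C \<in> carrier_mat n n"
    using mat_inverse(2)[OF A C] by auto
  have "C = C * (A * B)" using AC AB by simp
  also have "\<dots> = B" using AC A B by (simp add: assoc_mult_mat[symmetric])
  finally show ?thesis using C by (simp add: mat_inv_def)
qed

lemma mat_inv_rank_one_update:
  fixes u d :: "nat \<Rightarrow> real"
  assumes d: "\<And>i. i < n \<Longrightarrow> d i \<noteq> 0"
    and S: "1 + (\<Sum>k<n. (u k)\<^sup>2 / d k) \<noteq> 0"
  defines "A \<equiv> Matrix.mat n 1 (\<lambda>(i, _). u i)"
  shows "mat_inv (A * transpose_mat A + mat_diag n d) =
    Matrix.mat n n (\<lambda>(i, j). (if i = j then 1 / d j else 0) -
      (u i / d i) * (u j / d j) / (1 + (\<Sum>k<n. (u k)\<^sup>2 / d k)))" (is "_ = ?B")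
proof (rule mat_inv_eqI)
  define s where "s = (\<Sum>k<n. (u k)\<^sup>2 / d k)"
  show "A * transpose_mat A + mat_diag n d \<in> carrier_mat n n"
    unfolding A_def by (simp add: mat_diag_def)
  show "?B \<in> carrier_mat n n" by simp
  have entry: "(A * transpose_mat A + mat_diag n d) $$ (i, k) = u i * u k + (if i = k then d k else 0)"
    if "i < n" "k < n" for i k
    using that by (simp add: A_def mat_diag_def scalar_prod_def)
  show "(A * transpose_mat A + mat_diag n d) * ?B = 1\<^sub>m n"
  proof (rule eq_matI)
    fix i j assume "i < dim_row (1\<^sub>m n :: real Matrix.mat)" "j < dim_col (1\<^sub>m n :: real Matrix.mat)"
    then have i: "i < n" and j: "j < n" by auto
    \<comment> \<open>Column \<open>j\<close> of the candidate is the unit column divided by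
      \<open>d j\<close>, minus \<open>q\<close> times the column of all
      \<open>u k / d k\<close>.\<close>
    define q where "q = u j / d j / (1 + s)"
    have "((A * transpose_mat A + mat_diag n d) * ?B) $$ (i, j) =
      (\<Sum>k<n. (A * transpose_mat A + mat_diag n d) $$ (i, k) * ?B $$ (k, j))"
      using i j by (simp add: A_def mat_diag_def scalar_prod_def lessThan_atLeast0)
    also have "\<dots> = (\<Sum>k<n. (u i * u k + (if i = k then d k else 0)) *
        ((if k = j then 1 / d j else 0) - (u k / d k) * q))"
      using i j by (intro sum.cong) (auto simp: entry s_def q_def)
    \<comment> \<open>The first two terms come from the rank-one part, the last from the diagonal
      part. After summation, everything but the unit matrix cancels because
      \<open>u j / d j = q * (1 + s)\<close>.\<close>
    also have "\<dots> = (\<Sum>k<n. (if k = j then u i * u k / d j else 0)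
        - u i * q * ((u k)\<^sup>2 / d k)
        + (if k = i then (if i = j then 1 else 0) - u i * q else 0))"
      using d i by (intro sum.cong) (auto simp: algebra_simps power2_eq_square)
    also have "\<dots> = u i * u j / d j - u i * q * s + ((if i = j then 1 else 0) - u i * q)"
      using i j by (simp add: sum.distrib sum_subtractf sum_distrib_left[symmetric] s_def
          del: times_divide_eq_right)
    also have "\<dots> = (if i = j then 1 else 0)"
    proof -
      have "u j / d j = q * (1 + s)" using S by (simp add: q_def s_def)
      then have "u i * u j / d j = u i * (q * (1 + s))" by (metis times_divide_eq_right)
      then show ?thesis by (simp add: algebra_simps)
    qed
    finally show "((A * transpose_mat A + mat_diag n d) * ?B) $$ (i, j) = 1\<^sub>m n $$ (i, j)"
      using i j by simp
  qed (auto simp: A_def mat_diag_def)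
qed

lemma mat_inv_mat_diag:
  fixes d :: "nat \<Rightarrow> real"
  assumes "\<And>i. i < n \<Longrightarrow> d i \<noteq> 0"
  shows "mat_inv (mat_diag n d) = mat_diag n (\<lambda>i. 1 / d i)"
proof (rule mat_inv_eqI)
  show "mat_diag n d * mat_diag n (\<lambda>i. 1 / d i) = 1\<^sub>m n"
    using assms unfolding mat_diag_diag by (auto simp: mat_diag_def)
qed (auto simp: mat_diag_def)

lemma sum_lessThan_Suc_shift: "(\<Sum>i<n. f (Suc i)) = (\<Sum>j=1..n. f j)"
  by (rule sum.reindex_bij_witness[of _ "\<lambda>j. j - 1" Suc]) auto

text \<open>This is the scalar \<open>A^T Psi^-2 A\<close>, the Fisher information about
  \<open>w\<close> in the first \<open>D\<close> observations. With the prior precision 1 added, it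
  is the posterior precision of \<open>W\<close>.\<close>

definition precision_sum :: "(nat \<Rightarrow> real) \<Rightarrow> (nat \<Rightarrow> real) \<Rightarrow> nat \<Rightarrow> real" where
  "precision_sum alpha psi D = (\<Sum>j=1..D. (alpha j)\<^sup>2 / (psi j)\<^sup>2)"

lemma precision_sum_nonneg: "0 \<le> precision_sum alpha psi D"
  by (simp add: precision_sum_def sum_nonneg)

lemma factor_score_eq:
  assumes psi: "\<And>j. j \<ge> 1 \<Longrightarrow> psi j \<noteq> 0"
  shows "factor_score alpha psi D z =
    (\<Sum>j=1..D. alpha j / (psi j)\<^sup>2 * z j) / (1 + precision_sum alpha psi D)"
proof -
  \<comment> \<open>Matrix indices start at 0, the sequences of the model at 1.\<close>
  define u where "u i = alpha (Suc i)" for i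
  define d where "d i = (psi (Suc i))\<^sup>2" for i
  define s where "s = precision_sum alpha psi D"
  have s: "s = (\<Sum>k<D. (u k)\<^sup>2 / d k)"
    unfolding s_def precision_sum_def u_def d_def
    by (rule sum_lessThan_Suc_shift[of "\<lambda>j. (alpha j)\<^sup>2 / (psi j)\<^sup>2", symmetric])
  have s0: "1 + s \<noteq> 0" using precision_sum_nonneg[of alpha psi D] by (simp add: s_def)
  have d: "d i \<noteq> 0" for i using psi[of "Suc i"] by (simp add: d_def)
  define A where "A = Matrix.mat D 1 (\<lambda>(i, _). u i)"
  have A': "loading_mat D alpha = A" and d': "Psi_sq D psi = mat_diag D d"
    by (simp_all add: A_def u_def d_def[abs_def] loading_mat_def Psi_sq_def)
  define B where "B = Matrix.mat D D (\<lambda>(i, j). (if i = j then 1 / d j else 0) -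
      (u i / d i) * (u j / d j) / (1 + s))"
  have inv: "mat_inv (A * transpose_mat A + mat_diag D d) = B"
    unfolding A_def B_def s using s0 s d by (intro mat_inv_rank_one_update) auto
  \<comment> \<open>The push-through identity: multiplying the inverse by \<open>A^T\<close> turns
    the rank-one correction into the single factor \<open>1 / (1 + s)\<close>.\<close>
  have row: "(transpose_mat A * B) $$ (0, k) = u k / d k / (1 + s)" if k: "k < D" for k
  proof -
    define q where "q = u k / d k / (1 + s)"
    have "(transpose_mat A * B) $$ (0, k) =
        (\<Sum>i<D. u i * ((if i = k then 1 / d k else 0) - u i / d i * q))"
      using k by (simp add: A_def B_def scalar_prod_def lessThan_atLeast0 q_def mult.assoc)
    also have "\<dots> = (\<Sum>i<D. (if i = k then u i / d k else 0) - q * ((u i)\<^sup>2 / d i))"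
      by (intro sum.cong) (auto simp: power2_eq_square algebra_simps)
    also have "\<dots> = u k / d k - q * s"
      using k by (simp add: sum_subtractf sum_distrib_left[symmetric] s del: times_divide_eq_right)
    also have "\<dots> = q"
    proof -
      have "u k / d k = q * (1 + s)" using s0 by (simp add: q_def)
      then show ?thesis by (simp add: algebra_simps)
    qed
    also have "\<dots> = u k / d k / (1 + s)" by (simp add: q_def)
    finally show ?thesis .
  qed
  have "factor_score alpha psi D z =
      vec_index (transpose_mat A * B *\<^sub>v trunc_vec D z) 0"
    unfolding factor_score_def Let_def A' d' inv ..
  also have "\<dots> = (\<Sum>k<D. (transpose_mat A * B) $$ (0, k) * z (Suc k))"
    by (simp add: A_def B_def trunc_vec_def scalar_prod_def lessThan_atLeast0)
  also have "\<dots> = (\<Sum>k<D. alpha (Suc k) / (psi (Suc k))\<^sup>2 * z (Suc k)) / (1 + s)"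
    unfolding sum_divide_distrib by (intro sum.cong) (auto simp: row u_def d_def)
  also have "\<dots> = (\<Sum>j=1..D. alpha j / (psi j)\<^sup>2 * z j) / (1 + s)"
    using sum_lessThan_Suc_shift[of "\<lambda>j. alpha j / (psi j)\<^sup>2 * z j"] by simp
  finally show ?thesis by (simp add: s_def)
qed

lemma factor_score_alt_eq:
  assumes psi: "\<And>j. j \<ge> 1 \<Longrightarrow> psi j \<noteq> 0"
  shows "factor_score_alt alpha psi D z =
    (\<Sum>j=1..D. alpha j / (psi j)\<^sup>2 * z j) / (1 + precision_sum alpha psi D)"
proof -
  define u where "u i = alpha (Suc i)" for i
  define d where "d i = (psi (Suc i))\<^sup>2" for i
  define s where "s = precision_sum alpha psi D"
  have s: "s = (\<Sum>k<D. (u k)\<^sup>2 / d k)"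
    unfolding s_def precision_sum_def u_def d_def
    by (rule sum_lessThan_Suc_shift[of "\<lambda>j. (alpha j)\<^sup>2 / (psi j)\<^sup>2", symmetric])
  have s0: "1 + s \<noteq> 0" using precision_sum_nonneg[of alpha psi D] by (simp add: s_def)
  have d: "d i \<noteq> 0" for i using psi[of "Suc i"] by (simp add: d_def)
  define A where "A = Matrix.mat D 1 (\<lambda>(i, _). u i)"
  have A': "loading_mat D alpha = A" and d': "Psi_sq D psi = mat_diag D d"
    by (simp_all add: A_def u_def d_def[abs_def] loading_mat_def Psi_sq_def)
  define P where "P = mat_diag D (\<lambda>i. 1 / d i)"
  have A: "A \<in> carrier_mat D 1" and P: "P \<in> carrier_mat D D"
    by (simp_all add: A_def P_def mat_diag_def)
  have invP: "mat_inv (mat_diag D d) = P"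
    unfolding P_def using d by (rule mat_inv_mat_diag)
  define R where "R = Matrix.mat 1 D (\<lambda>(_, k). u k / d k)"
  have AP: "transpose_mat A * P = R"
    unfolding P_def using A by (subst mat_diag_mult_right[of _ 1]) (auto simp: A_def R_def)
  \<comment> \<open>With one factor the matrix to invert is 1 by 1, hence diagonal, and
    \<open>mat_inv_mat_diag\<close> applies again.\<close>
  have APA: "1\<^sub>m 1 + transpose_mat A * P * A = mat_diag 1 (\<lambda>_. 1 + s)"
    unfolding AP by (rule eq_matI)
      (auto simp: A_def R_def s mat_diag_def scalar_prod_def lessThan_atLeast0
        power2_eq_square intro!: sum.cong)
  have inv: "mat_inv (1\<^sub>m 1 + transpose_mat A * P * A) = mat_diag 1 (\<lambda>_. 1 / (1 + s))"
    unfolding APA using s0 by (intro mat_inv_mat_diag)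
  have "factor_score_alt alpha psi D z = vec_index
      (mat_inv (1\<^sub>m 1 + transpose_mat A * P * A) * transpose_mat A * P *\<^sub>v trunc_vec D z) 0"
    unfolding factor_score_alt_def Let_def A' d' invP ..
  also have "\<dots> = vec_index (mat_diag 1 (\<lambda>_. 1 / (1 + s)) * R *\<^sub>v trunc_vec D z) 0"
    unfolding inv AP[symmetric] using A P
    by (subst assoc_mult_mat[of _ 1 1 _ D _ D]) (auto simp: mat_diag_def)
  also have "\<dots> = (\<Sum>k<D. alpha (Suc k) / (psi (Suc k))\<^sup>2 * z (Suc k)) / (1 + s)"
    unfolding sum_divide_distrib
    by (subst mat_diag_mult_left[of _ _ D])
      (auto simp: R_def trunc_vec_def scalar_prod_def lessThan_atLeast0 u_def d_def intro!: sum.cong)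
  also have "\<dots> = (\<Sum>j=1..D. alpha j / (psi j)\<^sup>2 * z j) / (1 + s)"
    using sum_lessThan_Suc_shift[of "\<lambda>j. alpha j / (psi j)\<^sup>2 * z j"] by simp
  finally show ?thesis by (simp add: s_def)
qed

text \<open>The signal part of the observations contributes \<open>s * w / (1 + s)\<close>, which
  misses \<open>w\<close> by \<open>- w / (1 + s)\<close>: the shrinkage towards the prior mean 0.
  The rest is noise.\<close>

lemma factor_score_realized_obs_error:
  assumes psi: "\<And>j. j \<ge> 1 \<Longrightarrow> psi j \<noteq> 0"
  shows "factor_score alpha psi D (realized_obs alpha psi w e) - w =
    ((\<Sum>j=1..D. alpha j / psi j * e j) - w) / (1 + precision_sum alpha psi D)"
proof -
  define s where "s = precision_sum alpha psi D"
  have s0: "1 + s \<noteq> 0" using precision_sum_nonneg[of alpha psi D] by (simp add: s_def)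
  have "(\<Sum>j=1..D. alpha j / (psi j)\<^sup>2 * realized_obs alpha psi w e j) =
      (\<Sum>j=1..D. (alpha j)\<^sup>2 / (psi j)\<^sup>2 * w + alpha j / psi j * e j)"
    using psi by (intro sum.cong) (auto simp: realized_obs_def power2_eq_square field_simps)
  also have "\<dots> = s * w + (\<Sum>j=1..D. alpha j / psi j * e j)"
    by (simp add: sum.distrib sum_distrib_right s_def precision_sum_def)
  finally show ?thesis
    using s0 by (simp add: factor_score_eq[OF psi] s_def[symmetric] field_simps)
qed

section \<open>Second moments\<close>

lemma has_bochner_integral_square_sum_orthonormal:
  fixes X :: "'i \<Rightarrow> 'a \<Rightarrow> real"
  assumes "\<And>i j. i \<in> I \<Longrightarrow> j \<in> I \<Longrightarrow>
      has_bochner_integral M (\<lambda>\<omega>. X i \<omega> * X j \<omega>) (if i = j then 1 else 0)"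
    and "finite I"
  shows "has_bochner_integral M (\<lambda>\<omega>. (\<Sum>i\<in>I. b i * X i \<omega>)\<^sup>2) (\<Sum>i\<in>I. (b i)\<^sup>2)"
proof -
  have "has_bochner_integral M (\<lambda>\<omega>. \<Sum>i\<in>I. \<Sum>j\<in>I. (b i * b j) * (X i \<omega> * X j \<omega>))
      (\<Sum>i\<in>I. \<Sum>j\<in>I. (b i * b j) * (if i = j then 1 else 0))"
    using assms by (intro has_bochner_integral_sum has_bochner_integral_mult_right) auto
  moreover have "(\<Sum>i\<in>I. \<Sum>j\<in>I. (b i * b j) * (if i = j then 1 else 0)) = (\<Sum>i\<in>I. (b i)\<^sup>2)"
    using assms(2) by (simp add: if_distrib power2_eq_square cong: if_cong)
  ultimately show ?thesis
    by (simp add: power2_eq_square sum_product ac_simps)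
qed

lemma (in prob_space) std_normal_moments:
  assumes X: "distributed M lborel X std_normal_density"
  shows "has_bochner_integral M X 0" "has_bochner_integral M (\<lambda>\<omega>. X \<omega> * X \<omega>) 1"
proof -
  have *: "has_bochner_integral M (\<lambda>\<omega>. g (X \<omega>)) c"
    if "has_bochner_integral lborel (\<lambda>x. std_normal_density x * g x) c"
      and g: "g \<in> borel_measurable borel" for g :: "real \<Rightarrow> real" and c
    using that distributed_integrable[OF X, of g] distributed_integral[OF X, of g]
    by (simp add: has_bochner_integral_iff)
  show "has_bochner_integral M X 0"
    \<comment> \<open>The argument 0 selects the exponent \<open>2 * 0 + 1\<close>, and the argument
      1 below the exponent \<open>2 * 1\<close>, where the moment is
      \<open>fact 2 / (2 * fact 1) = 1\<close>.\<close>
    using *[of "\<lambda>x. x" 0] std_normal_moment_odd[of 0] by simp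
  show "has_bochner_integral M (\<lambda>\<omega>. X \<omega> * X \<omega>) 1"
    using *[of "\<lambda>x. x * x" 1] std_normal_moment_even[of 1] by (simp add: power2_eq_square)
qed

lemma (in gaussian_one_factor) eps_orthonormal:
  assumes "i \<ge> 1" "j \<ge> 1"
  shows "has_bochner_integral M (\<lambda>\<omega>. eps i \<omega> * eps j \<omega>) (if i = j then 1 else 0)"
proof (cases "i = j")
  case True
  then show ?thesis using std_normal_moments(2)[OF eps_normal[OF assms(1)]] by simp
next
  case False
  \<comment> \<open>Restrict the independent family to two singleton blocks and evaluate each at its
    only index. Since both indices are positive, neither block is the slot 0 occupied by
    \<open>W\<close>.\<close>
  have ind: "indep_var borel (eps i) borel (eps j)"
    using indep_var_compose[OF indep_var_restrict[OF W_eps_indep, of "{i}" "{j}"],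
        of "\<lambda>f. f i" borel "\<lambda>f. f j" borel] False assms
    by (simp add: comp_def)
  have "has_bochner_integral M (eps i) 0" "has_bochner_integral M (eps j) 0"
    using assms[THEN eps_normal, THEN std_normal_moments(1)] .
  then show ?thesis
    using False indep_var_integrable[OF ind] indep_var_lebesgue_integral[OF ind]
    by (simp add: has_bochner_integral_iff)
qed

lemma (in gaussian_one_factor) psi_nonzero: "j \<ge> 1 \<Longrightarrow> psi j \<noteq> 0"
  using psi_sq[of j] alpha_bounds[of j] abs_square_less_1[of "alpha j"] by auto

text \<open>Squared bias plus variance: the noise \<open>Y\<close> has mean 0 and second moment
  \<open>s\<close> by orthonormality of the disturbances, so \<open>Y - w\<close> has second moment
  \<open>s + w^2\<close>.\<close>

lemma (in gaussian_one_factor) factor_score_error_second_moment: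
  "has_bochner_integral M
     (\<lambda>\<omega>. (factor_score alpha psi D (realized_obs alpha psi w (\<lambda>j. eps j \<omega>)) - w)\<^sup>2)
     ((w\<^sup>2 + precision_sum alpha psi D) / (1 + precision_sum alpha psi D)\<^sup>2)"
proof -
  define s where "s = precision_sum alpha psi D"
  define Y where "Y \<omega> = (\<Sum>j=1..D. alpha j / psi j * eps j \<omega>)" for \<omega>
  have Y1: "has_bochner_integral M Y (\<Sum>j=1..D. alpha j / psi j * 0)"
    unfolding Y_def
    by (intro has_bochner_integral_sum has_bochner_integral_mult_right std_normal_moments(1) eps_normal)
      auto
  have Y2: "has_bochner_integral M (\<lambda>\<omega>. (Y \<omega>)\<^sup>2) s"
    using has_bochner_integral_square_sum_orthonormal
      [of "{1..D}" M eps "\<lambda>j. alpha j / psi j", OF eps_orthonormal]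
    by (simp add: Y_def s_def precision_sum_def power_divide)
  have "has_bochner_integral M (\<lambda>\<omega>. ((Y \<omega>)\<^sup>2 - 2 * w * Y \<omega> + w\<^sup>2) / (1 + s)\<^sup>2)
      ((s - 2 * w * (\<Sum>j=1..D. alpha j / psi j * 0) + w\<^sup>2) / (1 + s)\<^sup>2)"
    by (intro has_bochner_integral_divide_zero has_bochner_integral_add has_bochner_integral_diff
        has_bochner_integral_mult_right Y1 Y2)
      (auto simp: has_bochner_integral_iff prob_space)
  then show ?thesis
    by (simp add: factor_score_realized_obs_error[OF psi_nonzero] Y_def s_def power_divide
        power2_diff algebra_simps)
qed

section \<open>Markov's inequality and the linear growth of \<open>precision_sum\<close>\<close>

lemma (in prob_space) bigO_in_prob_of_second_moment:
  assumes meas: "\<And>n. X n \<in> borel_measurable M"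
    and int: "\<And>n. integrable M (\<lambda>\<omega>. (X n \<omega>)\<^sup>2)"
    and bound: "\<forall>\<^sub>F n in sequentially. expectation (\<lambda>\<omega>. (X n \<omega>)\<^sup>2) \<le> K * (r n)\<^sup>2"
    and r: "\<forall>\<^sub>F n in sequentially. r n \<noteq> 0"
  shows "bigO_in_prob M X r"
  unfolding bigO_in_prob_def
proof (intro conjI allI impI)
  fix \<delta> :: real assume \<delta>: "0 < \<delta>"
  \<comment> \<open>Markov's inequality will bound the probability by \<open>K / C^2\<close>. Taking
    \<open>\<bar>K\<bar> + 1\<close> in place of \<open>K\<close> makes \<open>C\<close> positive
    for every sign of \<open>K\<close> and the final inequality strict.\<close>
  define C where "C = sqrt ((\<bar>K\<bar> + 1) / \<delta>)"
  have C: "C > 0" "C\<^sup>2 = (\<bar>K\<bar> + 1) / \<delta>" using \<delta> by (auto simp: C_def)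
  have "\<forall>\<^sub>F n in sequentially. prob {\<omega> \<in> space M. \<bar>X n \<omega>\<bar> > C * \<bar>r n\<bar>} < \<delta>"
    using bound r
  proof eventually_elim
    case (elim n)
    note [measurable] = meas[of n]
    have r2: "(r n)\<^sup>2 > 0" using elim by simp
    have Cr: "(C * \<bar>r n\<bar>)\<^sup>2 > 0" using C elim by simp
    have "prob {\<omega> \<in> space M. \<bar>X n \<omega>\<bar> > C * \<bar>r n\<bar>} \<le> prob {\<omega> \<in> space M. (X n \<omega>)\<^sup>2 \<ge> (C * \<bar>r n\<bar>)\<^sup>2}"
      using C by (intro finite_measure_mono) (auto simp: abs_le_square_iff[symmetric] abs_mult)
    also have "\<dots> \<le> expectation (\<lambda>\<omega>. (X n \<omega>)\<^sup>2) / (C * \<bar>r n\<bar>)\<^sup>2"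
      using int Cr by (intro integral_Markov_inequality_measure[where A = "{}"]) auto
    also have "\<dots> \<le> K * (r n)\<^sup>2 / (C * \<bar>r n\<bar>)\<^sup>2"
      using elim by (intro divide_right_mono) auto
    also have "\<dots> = \<delta> * (K / (\<bar>K\<bar> + 1))"
      using r2 \<delta> by (simp add: power_mult_distrib C(2))
    also have "\<dots> < \<delta> * 1"
      using \<delta> by (intro mult_strict_left_mono) (auto simp: divide_simps)
    finally show ?case by simp
  qed
  with C show "\<exists>C>0. \<forall>\<^sub>F n in sequentially. prob {\<omega> \<in> space M. \<bar>X n \<omega>\<bar> > C * \<bar>r n\<bar>} < \<delta>"
    by blast
qed (rule meas)

text \<open>Cauchy-Schwarz against the constant 1, followed by \<open>psi j ^ 2 \<le> 1\<close>. The
  bound is phrased through the average of the absolute loadings, whose limit is assumed to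
  exist.\<close>

lemma (in gaussian_one_factor) precision_sum_ge:
  assumes D: "D \<ge> 1"
  shows "((\<Sum>j=1..D. \<bar>alpha j\<bar>) / real D)\<^sup>2 * real D \<le> precision_sum alpha psi D"
proof -
  have "((\<Sum>j=1..D. \<bar>alpha j\<bar>) / real D)\<^sup>2 * real D = (\<Sum>j=1..D. \<bar>alpha j\<bar>)\<^sup>2 / real D"
    using D by (simp add: power2_eq_square)
  also have "\<dots> \<le> (\<Sum>j=1..D. (alpha j)\<^sup>2)"
    using sum_squared_le_sum_of_squares[of "\<lambda>j. \<bar>alpha j\<bar>" "{1..D}"] D by (simp add: divide_simps)
  also have "\<dots> \<le> precision_sum alpha psi D"
    unfolding precision_sum_def
  proof (rule sum_mono)
    fix j assume "j \<in> {1..D}"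
    then have "0 < (psi j)\<^sup>2" "(psi j)\<^sup>2 \<le> 1"
      using psi_sq[of j] psi_nonzero[of j] by (simp_all only: zero_less_power2) simp_all
    then show "(alpha j)\<^sup>2 \<le> (alpha j)\<^sup>2 / (psi j)\<^sup>2"
      by (simp add: le_divide_eq mult_left_le)
  qed
  finally show ?thesis .
qed

theorem theorem2:
  fixes M :: "'a measure" and W :: "'a \<Rightarrow> real" and eps Z :: "nat \<Rightarrow> 'a \<Rightarrow> real"
    and alpha psi :: "nat \<Rightarrow> real" and c w0 :: real
  assumes "gaussian_one_factor M W eps Z alpha psi"
    and "-1 < liminf (\<lambda>j. ereal (alpha j))"
    and "liminf (\<lambda>j. ereal (alpha j)) < limsup (\<lambda>j. ereal (alpha j))"
    and "limsup (\<lambda>j. ereal (alpha j)) < 1"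
    and "(\<lambda>D. (\<Sum>j=1..D. \<bar>alpha j\<bar>) / real D) \<longlonglongrightarrow> c"
    and "c \<noteq> 0"
  shows "(\<forall>D\<ge>1. \<forall>z. factor_score alpha psi D z = factor_score_alt alpha psi D z) \<and>
    bigO_in_prob M
      (\<lambda>D \<omega>. factor_score alpha psi D (realized_obs alpha psi w0 (\<lambda>j. eps j \<omega>)) - w0)
      (\<lambda>D. real D powr (-1/2))"
proof (intro conjI allI impI)
  interpret gaussian_one_factor M W eps Z alpha psi by fact
  show "factor_score alpha psi D z = factor_score_alt alpha psi D z" for D z
    by (simp add: factor_score_eq factor_score_alt_eq psi_nonzero)
  \<comment> \<open>Any constant strictly between 0 and \<open>c^2\<close> would do: the squared
    averages tend to \<open>c^2\<close>, so they eventually exceed it.\<close>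
  define k where "k = c\<^sup>2 / 2"
  have k: "k > 0" using assms(6) by (simp add: k_def)
  have lim: "(\<lambda>D. ((\<Sum>j=1..D. \<bar>alpha j\<bar>) / real D)\<^sup>2) \<longlonglongrightarrow> c\<^sup>2"
    by (intro tendsto_power assms(5))
  have rate: "\<forall>\<^sub>F D in sequentially. k < ((\<Sum>j=1..D. \<bar>alpha j\<bar>) / real D)\<^sup>2"
    using order_tendstoD(1)[OF lim, of k] assms(6) by (simp add: k_def)
  let ?X = "\<lambda>D \<omega>. factor_score alpha psi D (realized_obs alpha psi w0 (\<lambda>j. eps j \<omega>)) - w0"
  show "bigO_in_prob M ?X (\<lambda>D. real D powr (-1/2))"
  proof (rule bigO_in_prob_of_second_moment[where K = "(w0\<^sup>2 + 1) / k"])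
    have [measurable]: "eps j \<in> borel_measurable M" if "j \<ge> 1" for j
      using distributed_measurable[OF eps_normal[OF that]] by simp
    show "?X D \<in> borel_measurable M" for D
      \<comment> \<open>The closed form shows that only disturbances of index at least 1 occur;
        nothing is known about the measurability of \<open>eps 0\<close>.\<close>
      by (subst factor_score_realized_obs_error[OF psi_nonzero]; measurable; simp)
    show "integrable M (\<lambda>\<omega>. (?X D \<omega>)\<^sup>2)" for D
      using factor_score_error_second_moment by (simp add: has_bochner_integral_iff)
    \<comment> \<open>At \<open>D = 0\<close> the rate is \<open>0 powr (-1/2) = 0\<close>, so this
      holds only from 1 on.\<close>
    show "\<forall>\<^sub>F D in sequentially. real D powr (-1/2) \<noteq> 0"
      using eventually_gt_at_top[of 0] by eventually_elim simp
    show "\<forall>\<^sub>F D in sequentially.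
        expectation (\<lambda>\<omega>. (?X D \<omega>)\<^sup>2) \<le> (w0\<^sup>2 + 1) / k * (real D powr (-1/2))\<^sup>2"
      using rate eventually_ge_at_top[of 1]
    proof eventually_elim
      case (elim D)
      define s where "s = precision_sum alpha psi D"
      have "k * real D \<le> ((\<Sum>j=1..D. \<bar>alpha j\<bar>) / real D)\<^sup>2 * real D"
        using elim by (intro mult_right_mono) auto
      also have "\<dots> \<le> s" unfolding s_def using elim by (intro precision_sum_ge) auto
      finally have ks: "k * real D \<le> s" .
      have kD: "0 < k * real D" using k elim by simp
      have "expectation (\<lambda>\<omega>. (?X D \<omega>)\<^sup>2) = (w0\<^sup>2 + s) / (1 + s)\<^sup>2"
        using factor_score_error_second_moment by (simp add: has_bochner_integral_iff s_def)
      \<comment> \<open>The numerators differ by \<open>w0^2 * s + 1\<close>, which is positive. One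
        factor \<open>1 + s\<close> then cancels, and the other is at least
        \<open>k * real D\<close>.\<close>
      also have "\<dots> \<le> ((w0\<^sup>2 + 1) * (1 + s)) / (1 + s)\<^sup>2"
        using ks kD by (intro divide_right_mono) (auto simp: algebra_simps)
      also have "\<dots> = (w0\<^sup>2 + 1) / (1 + s)"
        using ks kD by (simp add: power2_eq_square)
      also have "\<dots> \<le> (w0\<^sup>2 + 1) / (k * real D)"
        using ks kD by (intro divide_left_mono) (auto intro: add_nonneg_pos)
      also have "\<dots> = (w0\<^sup>2 + 1) / k * (real D powr (-1/2))\<^sup>2"
        using elim by (simp add: power2_eq_square powr_add[symmetric] powr_minus field_simps)
      finally show ?case .
    qed
  qed
qed

end
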